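(* Let $\mu\in\mathcal H$ with $\Re(\mu)=0$ and $m=N(\mu)$ squarefree, and let $r=1$ if $m\not\equiv 3\pmod 4$, $r=2$ if $m\equiv 3\pmod 4$. If the ideal $\mathfrak a=R_\mu(\rho)$ of $\mathcal O(\mu)$ with right pseudo generator $\rho$ is ambiguous, i.e. $\mathfrak a=\overline{\mathfrak a}$, then $\rho$ divides $(2/r)\mu$ from the right, i.e. $(2/r)\mu\rho^{-1}\in\mathcal H$.
   Context: Quaternions $q=t+xi+yj+zk$ with Hamilton's multiplication; $\Re(q)=t$, $\overline q=t-xi-yj-zk$, $N(q)=t^2+x^2+y^2+z^2$, $q^{-1}=\overline q/N(q)$. $\mathcal H$ is the ring of Hurwitz integral quaternions $(a+bi+cj+dk)/2$ with $a,b,c,d\in\mathbb Z$ all of the same parity. $s$ divides $q$ from the right if $q=\xi s$ with $\xi\in\mathcal H$; $\gcd_r(q,s)$ is a common right divisor of maximal norm. With $\omega=(r-1+\mu)/r$, $\mathcal O(\mu)=\mathbb Z+\mathbb Z\omega$ is a commutative subring of $\mathcal H$. Every nonzero ideal of $\mathcal O(\mu)$ has $\mathbb Z$-basis $c[a,b+\omega]$ ($c,a>0$, primitive if $c=1$); its right pseudo generator is $c\cdot\gcd_r(a,b+\omega)$ (unique up to a unit on the left), and $R_\mu(\rho)=\{\xi\rho:\xi\in\mathcal H,\ \xi\rho\in\mathcal O(\mu)\}$ is the ideal with right pseudo generator $\rho$. The conjugate of an ideal is $\overline{\mathfrak a}=\{\overline x:x\in\mathfrak a\}$.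
   Formalization: The ideal is additionally assumed primitive (c = 1 in its basis c[a, b+ω]); without this the claim fails, e.g. for μ = i and the ideal 3Z[i] with right pseudo generator ρ = 3, where 2i/3 is not a Hurwitz quaternion. *)

theory Defs
  imports
    Complex_Main
    "HOL-Algebra.Ideal"
    "HOL-Computational_Algebra.Squarefree"
begin

datatype quat = Quat (qre: real) (qi: real) (qj: real) (qk: real)

lemma quat_eq_iff: "p = q \<longleftrightarrow> qre p = qre q \<and> qi p = qi q \<and> qj p = qj q \<and> qk p = qk q"
  by (cases p; cases q) simp

definition qcnj :: "quat \<Rightarrow> quat" where
  "qcnj q = Quat (qre q) (- qi q) (- qj q) (- qk q)"

text \<open>The multiplicative norm \<open>N\<close>, i.e. the square of the Euclidean norm.\<close>

definition qnorm :: "quat \<Rightarrow> real" where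
  "qnorm q = (qre q)^2 + (qi q)^2 + (qj q)^2 + (qk q)^2"

instantiation quat :: division_ring
begin

definition "0 = Quat 0 0 0 0"
definition "1 = Quat 1 0 0 0"
definition "p + q = Quat (qre p + qre q) (qi p + qi q) (qj p + qj q) (qk p + qk q)"
definition "- q = Quat (- qre q) (- qi q) (- qj q) (- qk q)"
definition "p - q = Quat (qre p - qre q) (qi p - qi q) (qj p - qj q) (qk p - qk q)"
definition "p * q = Quat
  (qre p * qre q - qi p * qi q - qj p * qj q - qk p * qk q)
  (qre p * qi q + qi p * qre q + qj p * qk q - qk p * qj q)
  (qre p * qj q - qi p * qk q + qj p * qre q + qk p * qi q)
  (qre p * qk q + qi p * qj q - qj p * qi q + qk p * qre q)"
definition "inverse q = Quat (qre q / qnorm q) (- qi q / qnorm q) (- qj q / qnorm q) (- qk q / qnorm q)"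
definition "p div q = p * inverse (q :: quat)"

lemmas quat_defs = zero_quat_def one_quat_def plus_quat_def uminus_quat_def minus_quat_def
  times_quat_def inverse_quat_def divide_quat_def

lemma qnorm_eq_0_iff: "qnorm q = 0 \<longleftrightarrow> q = 0"
  unfolding qnorm_def
  by (auto simp: quat_eq_iff zero_quat_def add_nonneg_eq_0_iff)

instance
proof
  fix p :: quat
  assume "p \<noteq> 0"
  then have N: "qnorm p \<noteq> 0" by (simp add: qnorm_eq_0_iff)
  have sq: "qre p * qre p + qi p * qi p + qj p * qj p + qk p * qk p = qnorm p"
    by (simp add: qnorm_def power2_eq_square)
  show "inverse p * p = 1" "p * inverse p = 1"
    using N sq by (simp_all add: quat_eq_iff quat_defs algebra_simps flip: add_divide_distrib diff_divide_distrib)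
qed (simp_all add: quat_eq_iff quat_defs algebra_simps qnorm_def)

end

lemma quat_sel [simp]:
  "qre 0 = 0" "qi 0 = 0" "qj 0 = 0" "qk 0 = 0"
  "qre 1 = 1" "qi 1 = 0" "qj 1 = 0" "qk 1 = 0"
  "qre (p + q) = qre p + qre q" "qi (p + q) = qi p + qi q"
  "qj (p + q) = qj p + qj q" "qk (p + q) = qk p + qk q"
  "qre (p - q) = qre p - qre q" "qi (p - q) = qi p - qi q"
  "qj (p - q) = qj p - qj q" "qk (p - q) = qk p - qk q"
  "qre (- q) = - qre q" "qi (- q) = - qi q" "qj (- q) = - qj q" "qk (- q) = - qk q"
  by (simp_all add: quat_defs)

definition hurwitz :: "quat set" where
  "hurwitz = {Quat (of_int a / 2) (of_int b / 2) (of_int c / 2) (of_int d / 2) | a b c d :: int.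
     (even a \<longleftrightarrow> even b) \<and> (even b \<longleftrightarrow> even c) \<and> (even c \<longleftrightarrow> even d)}"

definition right_dvd :: "quat \<Rightarrow> quat \<Rightarrow> bool" where
  "right_dvd s q \<longleftrightarrow> (\<exists>\<xi>\<in>hurwitz. q = \<xi> * s)"

text \<open>A relation rather than a function, since right gcds are only unique up to a left unit.\<close>

definition is_right_gcd :: "quat \<Rightarrow> quat \<Rightarrow> quat \<Rightarrow> bool" where
  "is_right_gcd d q s \<longleftrightarrow>
     d \<in> hurwitz \<and> right_dvd d q \<and> right_dvd d s \<and>
     (\<forall>e\<in>hurwitz. right_dvd e q \<and> right_dvd e s \<longrightarrow> qnorm e \<le> qnorm d)"

definition omega :: "nat \<Rightarrow> quat \<Rightarrow> quat" where
  "omega r \<mu> = (of_nat r - 1 + \<mu>) / of_nat r"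

definition int_span2 :: "quat \<Rightarrow> quat \<Rightarrow> quat set" where
  "int_span2 x y = {of_int u * x + of_int v * y | u v :: int. True}"

definition is_int_basis2 :: "quat set \<Rightarrow> quat \<Rightarrow> quat \<Rightarrow> bool" where
  "is_int_basis2 A x y \<longleftrightarrow>
     A = int_span2 x y \<and>
     (\<forall>u v :: int. of_int u * x + of_int v * y = 0 \<longrightarrow> u = 0 \<and> v = 0)"

definition quad_order :: "nat \<Rightarrow> quat \<Rightarrow> quat set" where
  "quad_order r \<mu> = int_span2 1 (omega r \<mu>)"

definition quad_order_ring :: "nat \<Rightarrow> quat \<Rightarrow> quat ring" where
  "quad_order_ring r \<mu> =
     \<lparr>carrier = quad_order r \<mu>, monoid.mult = (*), one = 1, zero = 0, add = (+)\<rparr>"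

definition is_primitive :: "nat \<Rightarrow> quat \<Rightarrow> quat set \<Rightarrow> bool" where
  "is_primitive r \<mu> A \<longleftrightarrow>
     (\<exists>a b :: int. a > 0 \<and> is_int_basis2 A (of_int a) (of_int b + omega r \<mu>))"

definition is_right_pseudo_generator :: "nat \<Rightarrow> quat \<Rightarrow> quat set \<Rightarrow> quat \<Rightarrow> bool" where
  "is_right_pseudo_generator r \<mu> A \<rho> \<longleftrightarrow>
     (\<exists>(c :: int) (a :: int) (b :: int) d. c > 0 \<and> a > 0 \<and>
        is_int_basis2 A (of_int c * of_int a) (of_int c * (of_int b + omega r \<mu>)) \<and>
        is_right_gcd d (of_int a) (of_int b + omega r \<mu>) \<and>
        \<rho> = of_int c * d)"

definition R_ideal :: "nat \<Rightarrow> quat \<Rightarrow> quat \<Rightarrow> quat set" where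
  "R_ideal r \<mu> \<rho> = {\<xi> * \<rho> | \<xi>. \<xi> \<in> hurwitz \<and> \<xi> * \<rho> \<in> quad_order r \<mu>}"


lemma of_int_quat: "of_int n = Quat (of_int n) 0 0 0"
proof -
  have "of_nat n = Quat (of_nat n) 0 0 0" for n
    by (induction n) (simp_all add: quat_eq_iff)
  then show ?thesis
    by (cases n rule: int_cases2) (simp_all add: quat_eq_iff)
qed

lemma omega_eq:
  "omega (Suc 0) \<mu> = \<mu>"
  "omega 2 \<mu> = Quat ((1 + qre \<mu>) / 2) (qi \<mu> / 2) (qj \<mu> / 2) (qk \<mu> / 2)"
proof -
  have two: "(2 :: quat) = Quat 2 0 0 0"
    using of_int_quat[of 2] by simp
  show "omega (Suc 0) \<mu> = \<mu>"
    by (simp add: omega_def quat_eq_iff quat_defs qnorm_def)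
  show "omega 2 \<mu> = Quat ((1 + qre \<mu>) / 2) (qi \<mu> / 2) (qj \<mu> / 2) (qk \<mu> / 2)"
    unfolding omega_def of_nat_numeral two
    by (simp add: quat_eq_iff quat_defs qnorm_def power2_eq_square)
qed

text \<open>The hypotheses on \<open>r\<close> do make \<open>quad_order r \<mu>\<close> a commutative ring, so that
  the ideals of \<open>quad_order_ring r \<mu>\<close> are meaningful.\<close>

lemma quad_order_cring:
  assumes "qre \<mu> = 0" and N: "qnorm \<mu> = real m"
    and r: "r = (if m mod 4 = 3 then 2 else 1)"
  shows "cring (quad_order_ring r \<mu>)"
proof -
  let ?w = "omega r \<mu>"
  obtain s t :: int where sq: "?w * ?w = of_int s * ?w + of_int t"
  proof (cases "m mod 4 = 3")
    case True
    define n where "n = (m + 1) div 4"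
    have "m + 1 = 4 * n" using True unfolding n_def by presburger
    then have n: "real m = 4 * of_nat n - 1" by linarith
    have "?w * ?w = of_int 1 * ?w + of_int (- int n)"
      using True assms(1) N r n
      by (simp add: omega_eq quat_eq_iff of_int_quat qnorm_def times_quat_def power2_eq_square)
    then show ?thesis by (rule that)
  next
    case False
    have "?w * ?w = of_int 0 * ?w + of_int (- int m)"
      using False assms(1) N r
      by (simp add: omega_eq quat_eq_iff qnorm_def times_quat_def power2_eq_square
            of_int_quat[of "int m", simplified])
    then show ?thesis by (rule that)
  qed
  have comm: "x * of_int n = of_int n * x" for x :: quat and n
    by (simp add: of_int_quat times_quat_def)
  have com3: "x * (of_int n * y) = of_int n * (x * y)" for x y :: quat and n
    by (metis comm mult.assoc)
  have mem: "x \<in> quad_order r \<mu> \<longleftrightarrow> (\<exists>u v :: int. x = of_int u + of_int v * ?w)" for x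
    by (auto simp: quad_order_def int_span2_def)
  have prod: "(of_int u + of_int v * ?w) * (of_int u' + of_int v' * ?w) =
      of_int (u * u' + v * v' * t) + of_int (u * v' + v * u' + v * v' * s) * ?w" for u v u' v' :: int
  proof -
    have "(of_int u + of_int v * ?w) * (of_int u' + of_int v' * ?w) =
        of_int (u * u') + of_int (u * v' + v * u') * ?w + of_int (v * v') * (?w * ?w)"
      by (simp add: distrib_left distrib_right mult.assoc add.assoc comm[of ?w] com3[of ?w])
    also have "\<dots> = of_int (u * u' + v * v' * t) + of_int (u * v' + v * u' + v * v' * s) * ?w"
      unfolding sq by (simp add: distrib_left distrib_right mult.assoc add_ac)
    finally show ?thesis .
  qed
  show ?thesis
  proof (rule cringI)
    show "abelian_group (quad_order_ring r \<mu>)"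
    proof (rule abelian_groupI, goal_cases)
      case (1 x y)
      then obtain u v u' v' :: int where "x = of_int u + of_int v * ?w" "y = of_int u' + of_int v' * ?w"
        by (auto simp: quad_order_ring_def mem)
      then have "x + y = of_int (u + u') + of_int (v + v') * ?w"
        by (simp add: distrib_right add_ac)
      then show ?case unfolding quad_order_ring_def by (auto simp: mem simp del: of_int_add)
    next
      case 2
      have "0 = of_int 0 + of_int 0 * ?w" by simp
      then show ?case unfolding quad_order_ring_def by (auto simp: mem simp del: of_int_0)
    next
      case (6 x)
      then obtain u v :: int where "x = of_int u + of_int v * ?w"
        by (auto simp: quad_order_ring_def mem)
      then have "of_int (- u) + of_int (- v) * ?w + x = 0" by simp
      moreover have "of_int (- u) + of_int (- v) * ?w \<in> quad_order r \<mu>"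
        unfolding mem by blast
      ultimately show ?case by (auto simp only: quad_order_ring_def partial_object.simps ring.simps monoid.simps)
    qed (auto simp: quad_order_ring_def add_ac)
    show "comm_monoid (quad_order_ring r \<mu>)"
    proof (rule comm_monoidI, goal_cases)
      case (1 x y)
      then obtain u v u' v' :: int where "x = of_int u + of_int v * ?w" "y = of_int u' + of_int v' * ?w"
        by (auto simp: quad_order_ring_def mem)
      then have "x * y \<in> quad_order r \<mu>" using prod unfolding mem by blast
      then show ?case by (simp add: quad_order_ring_def)
    next
      case 2
      have "1 = of_int 1 + of_int 0 * ?w" by simp
      then show ?case unfolding quad_order_ring_def by (auto simp: mem simp del: of_int_0 of_int_1)
    next
      case (5 x y)
      then obtain u v u' v' :: int where "x = of_int u + of_int v * ?w" "y = of_int u' + of_int v' * ?w"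
        by (auto simp: quad_order_ring_def mem)
      moreover have "u * u' + v * v' * t = u' * u + v' * v * t"
        "u * v' + v * u' + v * v' * s = u' * v + v' * u + v' * v * s"
        by (simp_all add: mult.commute add.commute)
      ultimately have "x * y = y * x" by (simp only: prod)
      then show ?case by (simp add: quad_order_ring_def)
    qed (auto simp: quad_order_ring_def mult.assoc)
  qed (auto simp: quad_order_ring_def distrib_right)
qed

end

(* An ambiguous primitive ideal [a, b + \<omega>] contains the conjugate of b + \<omega>, hence also
   the difference \<omega> - cnj \<omega> = (2/r) \<mu>. Every element of R_\<mu>(\<rho>) is a left multiple of \<rho>. *)

theory Submission
  imports Defs
begin

lemma qcnj_add: "qcnj (p + q) = qcnj p + qcnj q"
  by (simp add: quat_eq_iff qcnj_def)

lemma qcnj_of_int [simp]: "qcnj (of_int n) = of_int n"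
  by (simp add: quat_eq_iff qcnj_def of_int_quat)

text \<open>Since \<mu> is purely imaginary, conjugation fixes the real part (r-1)/r of
  \<open>omega r \<mu>\<close> and negates the rest, \<mu>/r; subtracting doubles the
  latter.\<close>

lemma omega_minus_qcnj:
  assumes "qre \<mu> = 0" and "r = 1 \<or> r = 2"
  shows "omega r \<mu> - qcnj (omega r \<mu>) = (2 / of_nat r) * \<mu>"
proof -
  have two: "(2 :: quat) = Quat 2 0 0 0"
    using of_int_quat[of 2] by simp
  from assms(2) show ?thesis
  proof
    assume "r = 1"
    then show ?thesis
      using assms(1) by (simp add: omega_eq two quat_eq_iff qcnj_def times_quat_def divide_quat_def)
  next
    assume r: "r = 2"
    \<comment> \<open>A \<open>division_ring\<close> may have characteristic 2, so cancelling
      \<open>2 / of_nat 2\<close> requires this.\<close>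
    have "(2 :: quat) \<noteq> 0"
      by (simp add: two quat_eq_iff)
    then have "(2 / of_nat r) * \<mu> = \<mu>"
      by (simp add: r)
    moreover have "omega r \<mu> - qcnj (omega r \<mu>) = \<mu>"
      using assms(1) unfolding r omega_eq by (simp add: quat_eq_iff qcnj_def)
    ultimately show ?thesis
      by simp
  qed
qed

lemma int_span2_diff:
  assumes "p \<in> int_span2 x y" and "q \<in> int_span2 x y"
  shows "p - q \<in> int_span2 x y"
proof -
  obtain s t u v :: int where "p = of_int s * x + of_int t * y" "q = of_int u * x + of_int v * y"
    using assms by (auto simp: int_span2_def)
  then have "p - q = of_int (s - u) * x + of_int (t - v) * y"
    by (simp add: algebra_simps)
  then show ?thesis
    unfolding int_span2_def by blast
qed

lemma int_span2_right: "y \<in> int_span2 x y"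
proof -
  have "y = of_int 0 * x + of_int 1 * y" by simp
  then show ?thesis
    unfolding int_span2_def by blast
qed

theorem theorem1:
  fixes \<mu> \<rho> :: quat and m r :: nat and \<aa> :: "quat set"
  assumes "\<mu> \<in> hurwitz" and "qre \<mu> = 0"
    and "qnorm \<mu> = real m" and "squarefree m"
    and "r = (if m mod 4 = 3 then 2 else 1)"
    and "ideal \<aa> (quad_order_ring r \<mu>)"
    and "is_primitive r \<mu> \<aa>"
    and "is_right_pseudo_generator r \<mu> \<aa> \<rho>"
    and "\<aa> = R_ideal r \<mu> \<rho>"
    and "\<aa> = qcnj ` \<aa>"
  shows "right_dvd \<rho> ((2 / of_nat r) * \<mu>) \<and> (2 / of_nat r) * \<mu> * inverse \<rho> \<in> hurwitz"
proof -
  let ?\<omega> = "omega r \<mu>" and ?\<delta> = "(2 / of_nat r) * \<mu>"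
  have r: "r = 1 \<or> r = 2"
    using assms(5) by simp
  \<comment> \<open>The basis of a primitive ideal supplies both the element b + \<omega> and
    closure under subtraction.\<close>
  obtain a b :: int where span: "\<aa> = int_span2 (of_int a) (of_int b + ?\<omega>)"
    using assms(7) by (auto simp: is_primitive_def is_int_basis2_def)
  then have mem: "of_int b + ?\<omega> \<in> \<aa>"
    by (simp add: int_span2_right)
  then have "qcnj (of_int b + ?\<omega>) \<in> \<aa>"
    using assms(10) by blast
  then have "(of_int b + ?\<omega>) - qcnj (of_int b + ?\<omega>) \<in> \<aa>"
    using mem int_span2_diff unfolding span by blast
  \<comment> \<open>The integer b is its own conjugate and cancels.\<close>
  then have "?\<delta> \<in> \<aa>"
    by (simp add: qcnj_add omega_minus_qcnj[OF assms(2) r])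
  then obtain \<xi> where \<xi>: "\<xi> \<in> hurwitz" "?\<delta> = \<xi> * \<rho>"
    unfolding assms(9) R_ideal_def by blast
  \<comment> \<open>Squarefreeness excludes m = 0. Hence \<mu>, then \<open>?\<delta>\<close>, then
    its right factor \<rho> are nonzero, so \<rho> cancels against
    \<open>inverse \<rho>\<close>.\<close>
  have "\<mu> \<noteq> 0"
    using assms(3,4) qnorm_eq_0_iff[of \<mu>] by (auto intro: ccontr)
  then have "?\<delta> \<noteq> 0"
    using r omega_minus_qcnj[OF assms(2) r] by (auto simp: quat_eq_iff omega_eq qcnj_def assms(2))
  then have "\<rho> \<noteq> 0"
    using \<xi>(2) by auto
  \<comment> \<open>The Hurwitz cofactor is the quotient itself, so \<xi> witnesses both
    conjuncts.\<close>
  then have "?\<delta> * inverse \<rho> = \<xi>"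
    unfolding \<xi>(2) by (simp add: mult.assoc)
  with \<xi> show ?thesis
    unfolding right_dvd_def by auto
qed

end
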